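(* Let $p$ be an odd prime and $w\ge 1$ an integer. Then $p^{w+1}$ divides $2^{p-1}-1$ (i.e. $p$ is a Wieferich prime of order at least $w$) if and only if $p^{w+1}$ is an overpseudoprime to base 2.
   Context: A prime $p$ is a Wieferich prime of order $w\ge1$ if $p^{w+1}$ exactly divides $2^{p-1}-1$ (i.e. $p^{w+1}\mid 2^{p-1}-1$ but $p^{w+2}\nmid 2^{p-1}-1$). For an odd integer $m>1$, $h(m)$ denotes the multiplicative order of 2 modulo $m$. The cyclotomic cosets of 2 modulo $m$ are the orbits of $\{1,2,\ldots,m-1\}$ under $x\mapsto 2x \bmod m$; $r(m)$ is their number. An odd composite number $n$ is called an overpseudoprime to base 2 if $n=r(n)h(n)+1$. *)

theory Defs
  imports "HOL-Number_Theory.Number_Theory" "HOL-Combinatorics.Orbits"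
begin

text \<open>
  The library's \<^term>\<open>orbit f x\<close> starts at \<^term>\<open>f x\<close> rather than at \<^term>\<open>x\<close>. For odd
  \<^term>\<open>m\<close> this makes no difference: doubling permutes the residues modulo \<^term>\<open>m\<close>,
  so every \<^term>\<open>x\<close> below \<^term>\<open>m\<close> lies in its own orbit.
\<close>

definition cyclotomic_cosets :: "nat \<Rightarrow> nat set set" where
  "cyclotomic_cosets m = orbit (\<lambda>x. 2 * x mod m) ` {1..<m}"

definition num_cosets :: "nat \<Rightarrow> nat" where
  "num_cosets m = card (cyclotomic_cosets m)"

definition overpseudoprime_base_2 :: "nat \<Rightarrow> bool" where
  "overpseudoprime_base_2 n \<longleftrightarrow>
     odd n \<and> n > 1 \<and> \<not> prime n \<and> n = num_cosets n * ord n 2 + 1"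

end

theory Submission
  imports Defs
begin

text \<open>
  The coset of \<^term>\<open>x\<close> modulo \<^term>\<open>m\<close> has size \<^term>\<open>ord (m div gcd x m) 2\<close>, which divides
  \<^term>\<open>ord m 2\<close>. As the cosets partition \<^term>\<open>{1..<m}\<close>, the equation defining overpseudoprimes
  says that all of them have the maximal size \<^term>\<open>ord m 2\<close>, i.e. that 2 has the same order
  modulo every divisor \<^term>\<open>d > 1\<close> of \<^term>\<open>m\<close>. For a power of a prime \<^term>\<open>p\<close> this means
  that its order is already attained modulo \<^term>\<open>p\<close>. This order divides \<^term>\<open>p - 1\<close>, and
  conversely, if \<^term>\<open>p ^ k\<close> divides \<^term>\<open>2 ^ (p - 1) - 1\<close>, then it divides
  \<^term>\<open>2 ^ ord p 2 - 1\<close>, because the cofactor is a geometric sum congruent to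
  \<^term>\<open>(p - 1) div ord p 2\<close>, hence nonzero, modulo \<^term>\<open>p\<close>.
\<close>

lemma ord_dvd_ord_modulus:
  fixes d m a :: nat
  assumes "d dvd m"
  shows "ord d a dvd ord m a"
  using cong_dvd_modulus_nat[OF ord assms] by (simp only: ord_divides)

text \<open>Dividing by the gcd turns the congruence modulo \<open>m\<close> into one modulo
  \<open>d\<close>, in which the reduced factor \<open>y\<close> is a unit and cancels. What remains
  compares two powers of \<open>a\<close>, whose exponents matter only modulo the order.\<close>

lemma cong_power_mult_iff:
  fixes a x m :: nat
  assumes "coprime m a" "m > 0"
  shows "[a ^ j * x = a ^ k * x] (mod m) \<longleftrightarrow> [j = k] (mod ord (m div gcd x m) a)"
proof -
  define g d y where "g = gcd x m" and "d = m div g" and "y = x div g"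
  have g: "g > 0" and m: "m = g * d" and x: "x = g * y"
    using assms by (simp_all add: g_def d_def y_def)
  have y: "coprime y d"
    unfolding y_def d_def g_def using assms by (intro div_gcd_coprime) simp
  have d: "coprime d a"
    using assms m by simp
  have "[a ^ j * x = a ^ k * x] (mod m) \<longleftrightarrow> g * (a ^ j * y mod d) = g * (a ^ k * y mod d)"
    by (simp add: cong_def m x mult.left_commute[of _ g])
  also have "\<dots> \<longleftrightarrow> [a ^ j * y = a ^ k * y] (mod d)"
    using g by (simp add: cong_def)
  also have "\<dots> \<longleftrightarrow> [j = k] (mod ord d a)"
    using y d by (simp add: cong_mult_rcancel_nat order_divides_expdiff)
  finally show ?thesis
    by (simp add: d_def g_def)
qed

lemma funpow_mult_mod:
  fixes a x m :: nat
  assumes "x < m"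
  shows "((\<lambda>x. a * x mod m) ^^ k) x = a ^ k * x mod m"
  using assms by (induction k) (simp_all add: mod_mult_right_eq mult.assoc)

lemma
  fixes a x m :: nat
  assumes "coprime m a" "x < m"
  shows self_in_orbit_mult_mod: "x \<in> orbit (\<lambda>x. a * x mod m) x"
    and card_orbit_mult_mod: "card (orbit (\<lambda>x. a * x mod m) x) = ord (m div gcd x m) a"
proof -
  let ?f = "\<lambda>x. a * x mod m" and ?h = "ord (m div gcd x m) a"
  have "m div gcd x m dvd m"
    by (metis dvd_div_mult_self dvd_triv_left gcd_dvd2)
  \<comment> \<open>Positivity matters because \<open>orbit\<close> collects only the iterates with
    positive exponent.\<close>
  then have h: "?h > 0"
    using assms(1) coprime_divisors[of "m div gcd x m" m a a] by simp
  have "[a ^ ?h * x = a ^ 0 * x] (mod m)"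
    using assms by (subst cong_power_mult_iff) (auto simp: cong_def)
  then have period: "(?f ^^ ?h) x = x"
    using assms by (simp add: funpow_mult_mod cong_def)
  show "x \<in> orbit ?f x"
    unfolding orbit_altdef using period h by (metis (mono_tags, lifting) mem_Collect_eq)
  have "orbit ?f x = (\<lambda>k. a ^ k * x mod m) ` {..<?h}"
    using orbit_altdef_bounded[OF period h] assms by (auto simp: funpow_mult_mod)
  \<comment> \<open>\<open>?h\<close> is the least period: exponents below it with equal iterates
    are congruent modulo \<open>?h\<close>, hence equal.\<close>
  moreover have "inj_on (\<lambda>k. a ^ k * x mod m) {..<?h}"
    using cong_power_mult_iff[OF assms(1)] assms(2)
    by (intro inj_onI) (auto simp flip: cong_def intro: cong_less_modulus_unique_nat)
  ultimately show "card (orbit ?f x) = ?h"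
    by (simp add: card_image)
qed

text \<open>In general an orbit need not contain its starting point. When it does, the orbit of any
  of its points \<open>z\<close> leads back to the start, so two orbits sharing \<open>z\<close>
  both equal the orbit of \<open>z\<close>.\<close>

lemma orbits_eq_or_disjoint:
  assumes "\<And>x. x \<in> A \<Longrightarrow> x \<in> orbit f x" "x \<in> A" "y \<in> A"
  shows "orbit f x = orbit f y \<or> disjnt (orbit f x) (orbit f y)"
proof (cases "disjnt (orbit f x) (orbit f y)")
  case False
  then obtain z where z: "z \<in> orbit f x" "z \<in> orbit f y"
    by (auto simp: disjnt_def)
  have "orbit f x = orbit f z" "orbit f y = orbit f z"
    using z assms orbit_swap orbit_trans by (metis subsetI subset_antisym)+
  then show ?thesis by simp
qed simp

lemma Union_cyclotomic_cosets:
  assumes "odd m"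
  shows "\<Union>(cyclotomic_cosets m) = {1..<m}"
proof
  show "{1..<m} \<subseteq> \<Union>(cyclotomic_cosets m)"
    using assms self_in_orbit_mult_mod[of m 2] by (auto simp: cyclotomic_cosets_def)
next
  have "y \<in> {1..<m}" if x: "x \<in> {1..<m}" and y: "y \<in> orbit (\<lambda>x. 2 * x mod m) x" for x y
  proof -
    obtain k where k: "y = 2 ^ k * x mod m"
      using x y by (auto simp: orbit_altdef funpow_mult_mod)
    \<comment> \<open>A power of 2 is a unit modulo the odd number \<open>m\<close>, so the orbit of
      a nonzero residue never reaches 0.\<close>
    have "\<not> m dvd 2 ^ k * x"
      using x assms nat_dvd_not_less by (subst coprime_dvd_mult_right_iff) auto
    then show ?thesis
      using x k by (auto simp: dvd_eq_mod_eq_0 Suc_le_eq)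
  qed
  then show "\<Union>(cyclotomic_cosets m) \<subseteq> {1..<m}"
    unfolding cyclotomic_cosets_def by blast
qed

lemma num_cosets_mult_ord_iff:
  assumes "odd m" "m > 1"
  shows "m = num_cosets m * ord m 2 + 1 \<longleftrightarrow> (\<forall>d. d dvd m \<longrightarrow> d > 1 \<longrightarrow> ord d 2 = ord m 2)"
proof -
  let ?C = "cyclotomic_cosets m"
  have fin: "finite ?C"
    by (simp add: cyclotomic_cosets_def)
  have sizes: "card ` ?C = (\<lambda>d. ord d 2) ` {d. d dvd m \<and> d > 1}"
  proof -
    have "card ` ?C = (\<lambda>x. ord (m div gcd x m) 2) ` {1..<m}"
      using assms unfolding cyclotomic_cosets_def image_image
      by (intro image_cong card_orbit_mult_mod) auto
    also have "\<dots> = (\<lambda>d. ord d 2) ` (\<lambda>x. m div gcd x m) ` {1..<m}"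
      by (simp add: image_image)
    \<comment> \<open>The value 1 is excluded because \<open>0 < x < m\<close> forces
      \<open>gcd x m < m\<close>; a divisor \<open>d > 1\<close> is attained at its cofactor
      \<open>e\<close>, since \<open>gcd e m = e\<close>.\<close>
    also have "(\<lambda>x. m div gcd x m) ` {1..<m} = {d. d dvd m \<and> d > 1}"
    proof safe
      fix x assume x: "x \<in> {1..<m}"
      then have "gcd x m < m"
        by (metis atLeastLessThan_iff gcd_le1_nat le_less_trans not_one_le_zero)
      then show "m div gcd x m > 1"
        using dvd_div_mult_self[OF gcd_dvd2[of x m]] assms(2)
        by (cases "m div gcd x m") (auto intro!: gr0I)
      show "m div gcd x m dvd m"
        by (metis dvd_div_mult_self dvd_triv_left gcd_dvd2)
    next
      fix d assume d: "d dvd m" "d > 1"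
      then obtain e where e: "m = d * e" by blast
      with assms d have "e > 0"
        by (auto intro: gr0I)
      with e d have "e \<in> {1..<m}" "m div gcd e m = d"
        by (auto simp: gcd_nat.absorb1)
      then show "d \<in> (\<lambda>x. m div gcd x m) ` {1..<m}" by force
    qed
    finally show ?thesis .
  qed
  have le: "card c \<le> ord m 2" if "c \<in> ?C" for c
  proof -
    obtain d where "card c = ord d 2" "d dvd m"
      using sizes \<open>c \<in> ?C\<close> by blast
    then show ?thesis
      using assms ord_dvd_ord_modulus[of d m 2] by (auto intro!: dvd_imp_le)
  qed
  have "orbit (\<lambda>x. 2 * x mod m) x = orbit (\<lambda>x. 2 * x mod m) y \<or>
      disjnt (orbit (\<lambda>x. 2 * x mod m) x) (orbit (\<lambda>x. 2 * x mod m) y)"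
    if "x \<in> {1..<m}" "y \<in> {1..<m}" for x y
    using assms that by (intro orbits_eq_or_disjoint[of "{1..<m}"] self_in_orbit_mult_mod) auto
  then have disj: "pairwise disjnt ?C"
    unfolding cyclotomic_cosets_def pairwise_def by blast
  have "finite c" if "c \<in> ?C" for c
    using Union_cyclotomic_cosets[OF assms(1)] that by (metis Union_upper finite_atLeastLessThan finite_subset)
  then have "m - 1 = (\<Sum>c\<in>?C. card c)"
    using card_Union_disjoint[OF disj] Union_cyclotomic_cosets[OF assms(1)] by simp
  then have "m = num_cosets m * ord m 2 + 1 \<longleftrightarrow> (\<Sum>c\<in>?C. card c) = (\<Sum>c\<in>?C. ord m 2)"
    using assms by (auto simp: num_cosets_def)
  \<comment> \<open>By \<open>le\<close> the left sum is bounded term by term by the right one, so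
    equal sums force equal terms.\<close>
  also have "\<dots> \<longleftrightarrow> (\<forall>c\<in>?C. card c = ord m 2)"
    using sum_mono_inv[of card ?C "\<lambda>_. ord m 2"] le fin by auto
  also have "\<dots> \<longleftrightarrow> (\<forall>s\<in>card ` ?C. s = ord m 2)"
    by simp
  also have "\<dots> \<longleftrightarrow> (\<forall>d. d dvd m \<longrightarrow> d > 1 \<longrightarrow> ord d 2 = ord m 2)"
    unfolding sizes by auto
  finally show ?thesis .
qed

lemma overpseudoprime_prime_power_iff:
  assumes "prime p" "odd p" "k \<ge> 2"
  shows "overpseudoprime_base_2 (p ^ k) \<longleftrightarrow> ord (p ^ k) 2 = ord p 2"
proof -
  have gt: "p ^ k > 1"
    using assms by (intro one_less_power prime_gt_1_nat) auto
  have "\<not> prime (p ^ k)"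
    using assms by (simp add: prime_power_iff)
  then have "overpseudoprime_base_2 (p ^ k) \<longleftrightarrow>
      (\<forall>d. d dvd p ^ k \<longrightarrow> d > 1 \<longrightarrow> ord d 2 = ord (p ^ k) 2)"
    using num_cosets_mult_ord_iff[of "p ^ k"] assms gt
    by (simp add: overpseudoprime_base_2_def)
  also have "\<dots> \<longleftrightarrow> ord (p ^ k) 2 = ord p 2"
  proof
    assume "\<forall>d. d dvd p ^ k \<longrightarrow> d > 1 \<longrightarrow> ord d 2 = ord (p ^ k) 2"
    moreover have "p dvd p ^ k"
      using assms by simp
    ultimately show "ord (p ^ k) 2 = ord p 2"
      using prime_gt_1_nat[OF assms(1)] by metis
  next
    assume eq: "ord (p ^ k) 2 = ord p 2"
    show "\<forall>d. d dvd p ^ k \<longrightarrow> d > 1 \<longrightarrow> ord d 2 = ord (p ^ k) 2"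
    proof (intro allI impI)
      fix d assume d: "d dvd p ^ k" "d > 1"
      then obtain i where "d = p ^ i"
        using assms(1) by (auto simp: divides_primepow_nat)
      with d have "p dvd d"
        by (cases i) auto
      \<comment> \<open>The order modulo \<open>d\<close> is squeezed in the divisibility chain
        \<open>ord p 2\<close>, \<open>ord d 2\<close>, \<open>ord (p ^ k) 2\<close>, whose ends
        agree by \<open>eq\<close>.\<close>
      then show "ord d 2 = ord (p ^ k) 2"
        using ord_dvd_ord_modulus[of p d 2] ord_dvd_ord_modulus[of d "p ^ k" 2] d eq
        by (auto intro: dvd_antisym)
    qed
  qed
  finally show ?thesis .
qed

text \<open>The cofactor of \<open>x - 1\<close> in \<open>x ^ m - 1\<close> is a geometric sum
  congruent to \<open>m\<close> modulo \<open>p\<close>, so it is coprime to \<open>p ^ k\<close>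
  and can be cancelled. Over the integers \<open>x - 1\<close> is a genuine difference.\<close>

lemma prime_power_dvd_diff_1:
  fixes p x :: int
  assumes "prime p" "p dvd x - 1" "\<not> p dvd int m" "p ^ k dvd x ^ m - 1"
  shows "p ^ k dvd x - 1"
proof -
  have "[x = 1] (mod p)"
    using assms(2) by (simp add: cong_iff_dvd_diff)
  then have "[(\<Sum>i<m. x ^ i) = (\<Sum>i<m. 1 ^ i)] (mod p)"
    by (intro cong_sum cong_pow)
  then have "\<not> p dvd (\<Sum>i<m. x ^ i)"
    using assms(3) by (simp add: cong_dvd_iff)
  then have "coprime (p ^ k) (\<Sum>i<m. x ^ i)"
    using assms(1) by (simp add: prime_imp_coprime)
  with assms(4) show ?thesis
    by (simp add: power_diff_1_eq coprime_dvd_mult_left_iff)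
qed

lemma ord_prime_power_eq_iff:
  fixes p a :: nat
  assumes "prime p" "coprime p a" "k \<ge> 1"
  shows "ord (p ^ k) a = ord p a \<longleftrightarrow> [a ^ (p - 1) = 1] (mod p ^ k)"
proof
  have "ord p a dvd p - 1"
    using order_divides_totient[OF assms(2)] assms(1) by (simp add: totient_prime)
  then obtain m where m: "p - 1 = ord p a * m" by blast
  {
    assume "ord (p ^ k) a = ord p a"
    then show "[a ^ (p - 1) = 1] (mod p ^ k)"
      unfolding ord_divides m by simp
  next
    have iff: "[a ^ j = 1] (mod n) \<longleftrightarrow> int n dvd int a ^ j - 1" for j n
      by (metis cong_iff_dvd_diff cong_int_iff of_nat_1 of_nat_power)
    assume "[a ^ (p - 1) = 1] (mod p ^ k)"
    then have "int p ^ k dvd (int a ^ ord p a) ^ m - 1"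
      using iff[of "p - 1" "p ^ k"] by (metis m of_nat_power power_mult)
    moreover have "int p dvd int a ^ ord p a - 1"
      using ord[of a p] iff by blast
    moreover have "\<not> int p dvd int m"
    proof
      \<comment> \<open>As \<open>m\<close> divides \<open>p - 1\<close>, so would \<open>p\<close>,
        which is impossible because \<open>0 < p - 1 < p\<close>.\<close>
      assume "int p dvd int m"
      then have "p dvd p - 1"
        unfolding m by (simp add: int_dvd_int_iff)
      then show False
        using prime_gt_1_nat[OF assms(1)] by (auto dest: dvd_imp_le)
    qed
    ultimately have "int p ^ k dvd int a ^ ord p a - 1"
      using assms(1) prime_power_dvd_diff_1[of "int p" "int a ^ ord p a" m k] by simp
    then have "ord (p ^ k) a dvd ord p a"
      using iff[of "ord p a" "p ^ k"] by (simp add: ord_divides')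
    then show "ord (p ^ k) a = ord p a"
      using assms ord_dvd_ord_modulus[of p "p ^ k" a] by (auto intro: dvd_antisym)
  }
qed

theorem theorem4:
  fixes p w :: nat
  assumes "prime p" and "odd p" and "w \<ge> 1"
  shows "p ^ (w + 1) dvd 2 ^ (p - 1) - 1 \<longleftrightarrow> overpseudoprime_base_2 (p ^ (w + 1))"
proof -
  \<comment> \<open>The truncated subtraction is exact here, as \<open>2 ^ (p - 1)\<close> is at
    least 1.\<close>
  have "p ^ (w + 1) dvd 2 ^ (p - 1) - 1 \<longleftrightarrow> [2 ^ (p - 1) = 1] (mod p ^ (w + 1))"
    by (simp add: cong_altdef_nat)
  also have "\<dots> \<longleftrightarrow> ord (p ^ (w + 1)) 2 = ord p 2"
    using assms by (intro ord_prime_power_eq_iff[symmetric]) auto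
  also have "\<dots> \<longleftrightarrow> overpseudoprime_base_2 (p ^ (w + 1))"
    using assms by (intro overpseudoprime_prime_power_iff[symmetric]) auto
  finally show ?thesis .
qed

end
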